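(* Let $\alpha=0.6$ and $T_{\max}=20$, and let the inherent risk score of an agent be $R=\alpha\cdot(I\times A)+(1-\alpha)\cdot\mathcal{T}$, with impact score $I$, degree of autonomy $A$, weighted tool complexity score $\mathcal{T}$ and tiers as in the context. (1) An agent with $I=10$, $A=5$ satisfies $R\ge 0.6\times 50=30>28.5$ and is automatically Tier 1 regardless of its toolset. (2) Conversely, the tool term is bounded: its maximum contribution is $(1-\alpha)\,T_{\max}=0.4\times 20=8.0$, strictly below the Tier 2 cutoff of $15.2$, so tool breadth alone can never lift an agent above Tier 3. (3) For instance, the agent AG-17, a read-only agent with $A=1$, $I=2$ and 60 Class-1 tools (the largest toolset in the 17-agent inventory considered), has raw tool score $60\times 0.5=30$, capped to $\mathcal{T}=\min(30,20)=20$, giving $R=0.6\times 2+0.4\times 20=9.2$, which is correctly Tier 3; a naive additive score $I\times A+\sum_s w_s n_s=2+30=32$ would wrongly rank it near the top tier. (4) Tier assignment and runtime quarantine are decoupled: a Tier 1 agent with a high inherent risk score is not automatically quarantined; it is quarantined only when upstream failures propagate to it. Conflating the two would render all high-tier agents inoperative by design.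
   Context: The impact score is $I\in\{1,\ldots,10\}$ (maximum potential financial or operational harm from an incorrect or adversarially induced output) and the degree of autonomy is $A\in\{1,\ldots,5\}$ (from 1, every action needs human approval, to 5, no human review of individual actions). Each tool of an agent belongs to a severity class $s\in\{1,2,3,4\}$ with weight $w_1=0.5$ (read-only, internal data), $w_2=1.0$ (read-only, external API), $w_3=2.5$ (write access, reversible), $w_4=5.0$ (write access, irreversible). If $n_s$ is the number of registered tools of severity class $s$ in the agent's declared toolset (not a runtime invocation count), the weighted tool complexity score is $\mathcal{T}=\min\bigl(\sum_{s} w_s n_s,\;T_{\max}\bigr)$. The maximal score is $R_{\max}=0.6\times 50+0.4\times 20=38.0$. Tiers are assigned by: Tier 1 if $R\ge 0.75\,R_{\max}=28.5$; Tier 2 if $0.40\,R_{\max}=15.2\le R<28.5$; Tier 3 if $R<15.2$. Tier 1 is the highest tier and Tier 3 the lowest. Runtime quarantine through propagation of failures: agents are nodes of a directed acyclic dependency graph, in which an edge from $v_i$ to $v_j$ means that $v_j$ consumes the output of $v_i$ or invokes $v_i$ as a tool. An agent that fails its own behavioral test has status Failed; an agent that does not itself fail is quarantined (status Blocked) exactly when at least one of its ancestors in this graph (agents from which there is a directed path to it) is Failed or Blocked. *)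

theory Defs
  imports Complex_Main
begin

datatype severity = Class1 | Class2 | Class3 | Class4

fun weight :: "severity \<Rightarrow> real" where
  "weight Class1 = 0.5"
| "weight Class2 = 1.0"
| "weight Class3 = 2.5"
| "weight Class4 = 5.0"

text \<open>The declared toolset is a finite partial map from the names of the registered tools to
  their severity classes, so every registered tool has exactly one class.\<close>

record agent =
  impact :: nat
  autonomy :: nat
  toolset :: "string \<rightharpoonup> severity"

definition valid_agent :: "agent \<Rightarrow> bool" where
  "valid_agent a \<longleftrightarrow>
     impact a \<in> {1..10} \<and> autonomy a \<in> {1..5} \<and> finite (dom (toolset a))"

definition tool_count :: "agent \<Rightarrow> severity \<Rightarrow> nat" where
  "tool_count a s = card {t. toolset a t = Some s}"

definition alpha :: real where "alpha = 0.6"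

definition T_max :: real where "T_max = 20"

definition raw_tool_score :: "agent \<Rightarrow> real" where
  "raw_tool_score a = (\<Sum>s\<in>{Class1, Class2, Class3, Class4}. weight s * real (tool_count a s))"

definition tool_score :: "agent \<Rightarrow> real" where
  "tool_score a = min (raw_tool_score a) T_max"

definition risk_score :: "agent \<Rightarrow> real" where
  "risk_score a =
     alpha * (real (impact a) * real (autonomy a)) + (1 - alpha) * tool_score a"

definition naive_score :: "agent \<Rightarrow> real" where
  "naive_score a = real (impact a) * real (autonomy a) + raw_tool_score a"

definition R_max :: real where "R_max = alpha * 50 + (1 - alpha) * T_max"

datatype tier = Tier1 | Tier2 | Tier3

definition tier_of_score :: "real \<Rightarrow> tier" where
  "tier_of_score r =
     (if r \<ge> 0.75 * R_max then Tier1 else if r \<ge> 0.40 * R_max then Tier2 else Tier3)"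

definition tier :: "agent \<Rightarrow> tier" where
  "tier a = tier_of_score (risk_score a)"

text \<open>\<open>(u, v) \<in> deps S\<close> is an edge from \<open>u\<close> to \<open>v\<close>: agent \<open>v\<close> consumes the output of \<open>u\<close> or
  invokes \<open>u\<close> as a tool. \<open>failing S\<close> are the agents that fail their own behavioral test.\<close>

record 'v agent_system =
  nodes :: "'v set"
  deps :: "('v \<times> 'v) set"
  failing :: "'v set"
  profile :: "'v \<Rightarrow> agent"

definition wf_system :: "'v agent_system \<Rightarrow> bool" where
  "wf_system S \<longleftrightarrow>
     finite (nodes S) \<and> deps S \<subseteq> nodes S \<times> nodes S \<and> acyclic (deps S) \<and>
     failing S \<subseteq> nodes S \<and> (\<forall>v\<in>nodes S. valid_agent (profile S v))"

datatype status = Operational | Failed | Blocked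

inductive blocked :: "'v agent_system \<Rightarrow> 'v \<Rightarrow> bool" for S where
  "\<lbrakk>v \<in> nodes S; v \<notin> failing S; (u, v) \<in> (deps S)\<^sup>+; u \<in> failing S \<or> blocked S u\<rbrakk>
     \<Longrightarrow> blocked S v"

definition status :: "'v agent_system \<Rightarrow> 'v \<Rightarrow> status" where
  "status S v =
     (if v \<in> failing S then Failed else if blocked S v then Blocked else Operational)"

text \<open>On a well-formed system \<open>status\<close> is the only assignment of statuses that obeys the
  quarantine rule.\<close>

definition obeys_quarantine_rule :: "'v agent_system \<Rightarrow> ('v \<Rightarrow> status) \<Rightarrow> bool" where
  "obeys_quarantine_rule S st \<longleftrightarrow>
     (\<forall>v\<in>nodes S. (st v = Failed \<longleftrightarrow> v \<in> failing S) \<and>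
        (st v = Blocked \<longleftrightarrow> v \<notin> failing S \<and>
           (\<exists>u\<in>nodes S. (u, v) \<in> (deps S)\<^sup>+ \<and> st u \<in> {Failed, Blocked})))"

lemma status_obeys_quarantine_rule:
  assumes "wf_system S"
  shows "obeys_quarantine_rule S (status S)"
proof -
  have sub: "u \<in> nodes S" if "(u, v) \<in> (deps S)\<^sup>+" for u v
    using that assms unfolding wf_system_def by (metis SigmaD1 subsetD tranclD)
  have "blocked S v \<longleftrightarrow> v \<notin> failing S \<and>
          (\<exists>u\<in>nodes S. (u, v) \<in> (deps S)\<^sup>+ \<and> (u \<in> failing S \<or> blocked S u))"
    if "v \<in> nodes S" for v
    by (subst blocked.simps) (use that sub in blast)
  moreover have "status S u \<in> {Failed, Blocked} \<longleftrightarrow> u \<in> failing S \<or> blocked S u" for u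
    by (simp add: status_def)
  moreover have "status S u = Failed \<longleftrightarrow> u \<in> failing S" for u
    by (simp add: status_def)
  moreover have "status S u = Blocked \<longleftrightarrow> u \<notin> failing S \<and> blocked S u" for u
    by (simp add: status_def)
  ultimately show ?thesis
    unfolding obeys_quarantine_rule_def by blast
qed

lemma status_unique:
  assumes wf: "wf_system S" and st: "obeys_quarantine_rule S st" and "v \<in> nodes S"
  shows "st v = status S v"
proof -
  have "finite (deps S)"
    using wf unfolding wf_system_def by (meson finite_SigmaI finite_subset)
  then have "wf ((deps S)\<^sup>+)"
    using wf unfolding wf_system_def by (simp add: finite_acyclic_wf wf_trancl)
  then show ?thesis using \<open>v \<in> nodes S\<close>
  proof (induction v rule: wf_induct_rule)
    case (less v)
    have *: "obeys_quarantine_rule S (status S)"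
      using wf by (rule status_obeys_quarantine_rule)
    have F: "st v = Failed \<longleftrightarrow> status S v = Failed"
      using * st less.prems unfolding obeys_quarantine_rule_def by blast
    have "(\<exists>u\<in>nodes S. (u, v) \<in> (deps S)\<^sup>+ \<and> st u \<in> {Failed, Blocked}) \<longleftrightarrow>
          (\<exists>u\<in>nodes S. (u, v) \<in> (deps S)\<^sup>+ \<and> status S u \<in> {Failed, Blocked})"
      using less.IH by metis
    then have "st v = Blocked \<longleftrightarrow> status S v = Blocked"
      using * st less.prems unfolding obeys_quarantine_rule_def by blast
    with F show ?case by (metis status.exhaust)
  qed
qed

text \<open>The rule that conflates tier and quarantine: being Tier 1 is itself a reason for
  quarantine, next to the propagation of failures.\<close>

inductive conflated_blocked :: "'v agent_system \<Rightarrow> 'v \<Rightarrow> bool" for S where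
  "\<lbrakk>v \<in> nodes S; v \<notin> failing S; tier (profile S v) = Tier1\<rbrakk> \<Longrightarrow> conflated_blocked S v"
| "\<lbrakk>v \<in> nodes S; v \<notin> failing S; (u, v) \<in> (deps S)\<^sup>+; u \<in> failing S \<or> conflated_blocked S u\<rbrakk>
     \<Longrightarrow> conflated_blocked S v"

definition conflated_status :: "'v agent_system \<Rightarrow> 'v \<Rightarrow> status" where
  "conflated_status S v =
     (if v \<in> failing S then Failed else if conflated_blocked S v then Blocked else Operational)"

end

theory Submission
  imports Defs
begin

text \<open>The scoring claims are arithmetic with \<open>R_max = 38\<close>: the tool term lies
  between 0 and 0.4 * 20 = 8 (\<open>tool_score_nonneg\<close>, \<open>tool_score_le\<close>), too
  little to reach 15.2 and never able to pull a score of 30 below 28.5. The quarantine claims rest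
  on \<open>blocked_iff\<close>: the recursion collapses to having a failing ancestor, a condition
  on the graph and the failures in which no score occurs.\<close>

lemma R_max_eq: "R_max = 38"
  by (simp add: R_max_def alpha_def T_max_def)

lemma tier_of_score_eq:
  "tier_of_score r = (if r \<ge> 28.5 then Tier1 else if r \<ge> 15.2 then Tier2 else Tier3)"
  by (simp add: tier_of_score_def R_max_eq)

lemma raw_tool_score_eq:
  "raw_tool_score a = 0.5 * real (tool_count a Class1) + real (tool_count a Class2)
     + 2.5 * real (tool_count a Class3) + 5 * real (tool_count a Class4)"
  by (simp add: raw_tool_score_def)

lemma tool_score_nonneg: "0 \<le> tool_score a"
  by (simp add: tool_score_def T_max_def raw_tool_score_eq)

lemma tool_score_le: "tool_score a \<le> 20"
  by (simp add: tool_score_def T_max_def)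

lemma risk_score_eq:
  "risk_score a = 0.6 * (real (impact a) * real (autonomy a)) + 0.4 * tool_score a"
  by (simp add: risk_score_def alpha_def)

lemma ex_tool_score_eq_T_max: "\<exists>a. valid_agent a \<and> tool_score a = T_max"
proof -
  \<comment> \<open>Four tools of weight 5 reach the cap of 20 exactly; the other summands are
    nonnegative, so the minimum is \<open>T_max\<close>.\<close>
  define m :: "string \<rightharpoonup> severity"
    where "m = [''a'' \<mapsto> Class4, ''b'' \<mapsto> Class4, ''c'' \<mapsto> Class4, ''d'' \<mapsto> Class4]"
  define a where "a = \<lparr>impact = 1, autonomy = 1, toolset = m\<rparr>"
  have "{t. m t = Some Class4} = {''a'', ''b'', ''c'', ''d''}"
    by (auto simp: m_def)
  then have "tool_count a Class4 = 4"
    by (simp add: tool_count_def a_def)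
  then have "tool_score a = T_max"
    by (simp add: tool_score_def T_max_def raw_tool_score_eq)
  moreover have "valid_agent a"
    by (simp add: valid_agent_def a_def m_def)
  ultimately show ?thesis by blast
qed

text \<open>Following blocked ancestors upwards leads to a failing one, and transitivity of
  \<open>(deps S)\<^sup>+\<close> joins the paths into one.\<close>

lemma blocked_iff:
  "blocked S v \<longleftrightarrow> v \<in> nodes S \<and> v \<notin> failing S \<and> (\<exists>u\<in>failing S. (u, v) \<in> (deps S)\<^sup>+)"
proof
  assume "blocked S v"
  then show "v \<in> nodes S \<and> v \<notin> failing S \<and> (\<exists>u\<in>failing S. (u, v) \<in> (deps S)\<^sup>+)"
    by induction (auto intro: trancl_trans)
qed (auto intro: blocked.intros)

lemma status_eq_Blocked_iff:
  assumes "v \<in> nodes S"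
  shows "status S v = Blocked \<longleftrightarrow> v \<notin> failing S \<and> (\<exists>u\<in>failing S. (u, v) \<in> (deps S)\<^sup>+)"
  using assms by (simp add: status_def blocked_iff)

text \<open>By \<open>blocked_iff\<close>, only \<open>nodes\<close>, \<open>deps\<close> and
  \<open>failing\<close> enter the status; this is the decoupling from tiers.\<close>

lemma status_profile_update: "status (S\<lparr>profile := p\<rparr>) v = status S v"
  by (simp add: status_def blocked_iff)

lemma ex_system_with_status:
  assumes "valid_agent a"
  shows "\<exists>S :: nat agent_system. wf_system S \<and> (\<exists>v\<in>nodes S. profile S v = a \<and> status S v = st)"
proof -
  \<comment> \<open>On the single edge from 0 to 1, node 1 gets the desired status when nothing,
    node 1 itself, or its predecessor fails.\<close>
  define F :: "nat set"
    where "F = (case st of Operational \<Rightarrow> {} | Failed \<Rightarrow> {1} | Blocked \<Rightarrow> {0})"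
  define S :: "nat agent_system"
    where "S = \<lparr>nodes = {0, 1}, deps = {(0, 1)}, failing = F, profile = \<lambda>_. a\<rparr>"
  have "acyclic {(0 :: nat, 1 :: nat)}"
    by (rule wf_acyclic) (rule wf_subset[OF wf_less], auto)
  then have "wf_system S"
    using assms by (auto simp: wf_system_def S_def F_def split: status.split)
  moreover have "status S 1 = st"
    by (cases st) (auto simp: status_def blocked_iff S_def F_def)
  moreover have "1 \<in> nodes S" "profile S 1 = a"
    by (simp_all add: S_def)
  ultimately show ?thesis by blast
qed

text \<open>The first rule of \<open>conflated_blocked\<close> fires without any upstream
  failure.\<close>

lemma conflated_status_Tier1:
  assumes "v \<in> nodes S" "tier (profile S v) = Tier1"
  shows "conflated_status S v = (if v \<in> failing S then Failed else Blocked)"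
  using assms by (simp add: conflated_status_def conflated_blocked.intros(1))

lemma status_no_failing:
  assumes "failing S = {}"
  shows "status S v = Operational"
  using assms by (simp add: status_def blocked_iff)

theorem mainTheorem2:
  "\<comment> \<open>the cutoffs\<close>
   R_max = 38.0 \<and> 0.75 * R_max = 28.5 \<and> 0.40 * R_max = 15.2 \<and>
   \<comment> \<open>maximal impact and autonomy force Tier 1\<close>
   (\<forall>a. valid_agent a \<and> impact a = 10 \<and> autonomy a = 5 \<longrightarrow>
      risk_score a \<ge> alpha * 50 \<and> alpha * 50 = 30 \<and> 30 > 0.75 * R_max \<and> tier a = Tier1) \<and>
   \<comment> \<open>the tool term is bounded (and the bound is attained); tool breadth alone stays in Tier 3\<close>
   (\<forall>a. valid_agent a \<longrightarrow> (1 - alpha) * tool_score a \<le> (1 - alpha) * T_max) \<and>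
   (\<exists>a. valid_agent a \<and> (1 - alpha) * tool_score a = (1 - alpha) * T_max) \<and>
   (1 - alpha) * T_max = 8.0 \<and> 8.0 < 0.40 * R_max \<and>
   (\<forall>a. valid_agent a \<longrightarrow> tier_of_score ((1 - alpha) * tool_score a) = Tier3) \<and>
   (\<forall>a. valid_agent a \<and> impact a = 1 \<and> autonomy a = 1 \<longrightarrow> tier a = Tier3) \<and>
   \<comment> \<open>the agent AG-17, against the naive additive score\<close>
   (\<forall>a. valid_agent a \<and> autonomy a = 1 \<and> impact a = 2 \<and> tool_count a Class1 = 60 \<and>
        tool_count a Class2 = 0 \<and> tool_count a Class3 = 0 \<and> tool_count a Class4 = 0 \<longrightarrow>
      raw_tool_score a = 60 * 0.5 \<and> raw_tool_score a = 30 \<and>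
      tool_score a = min 30 20 \<and> tool_score a = 20 \<and>
      risk_score a = 0.6 * 2 + 0.4 * 20 \<and> risk_score a = 9.2 \<and> tier a = Tier3 \<and>
      naive_score a = 2 + 30 \<and> naive_score a = 32 \<and> tier_of_score (naive_score a) = Tier1) \<and>
   \<comment> \<open>quarantine happens exactly through upstream failures and does not depend on the
       profiles (hence not on the tiers)\<close>
   (\<forall>S :: 'v agent_system. \<forall>v\<in>nodes S. wf_system S \<longrightarrow>
      (status S v = Blocked \<longleftrightarrow>
         v \<notin> failing S \<and> (\<exists>u\<in>failing S. (u, v) \<in> (deps S)\<^sup>+)) \<and>
      (\<forall>p. (\<forall>w\<in>nodes S. valid_agent (p w)) \<longrightarrow>
         status (S\<lparr>profile := p\<rparr>) v = status S v)) \<and>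
   \<comment> \<open>every agent, in particular every Tier 1 agent, can have every status\<close>
   (\<forall>a st. valid_agent a \<longrightarrow>
      (\<exists>S :: nat agent_system. wf_system S \<and>
         (\<exists>v\<in>nodes S. profile S v = a \<and> status S v = st))) \<and>
   \<comment> \<open>conflation makes all Tier 1 agents inoperative, even when no agent fails at all\<close>
   (\<forall>S :: 'v agent_system. \<forall>v\<in>nodes S. wf_system S \<and> tier (profile S v) = Tier1 \<longrightarrow>
      conflated_status S v \<noteq> Operational \<and>
      (failing S = {} \<longrightarrow> conflated_status S v = Blocked \<and> status S v = Operational))"
proof (intro conjI)
  show "\<forall>a. valid_agent a \<and> impact a = 10 \<and> autonomy a = 5 \<longrightarrow>
      risk_score a \<ge> alpha * 50 \<and> alpha * 50 = 30 \<and> 30 > 0.75 * R_max \<and> tier a = Tier1"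
    using tool_score_nonneg
    by (auto simp: risk_score_eq alpha_def R_max_eq tier_def tier_of_score_eq add_increasing2)
  show "\<forall>a. valid_agent a \<longrightarrow> tier_of_score ((1 - alpha) * tool_score a) = Tier3"
  proof (intro allI impI)
    fix a
    show "tier_of_score ((1 - alpha) * tool_score a) = Tier3"
      using tool_score_le[of a] by (simp add: tier_of_score_eq alpha_def)
  qed
  show "\<forall>a. valid_agent a \<and> impact a = 1 \<and> autonomy a = 1 \<longrightarrow> tier a = Tier3"
  proof (intro allI impI)
    fix a assume "valid_agent a \<and> impact a = 1 \<and> autonomy a = 1"
    then show "tier a = Tier3"
      \<comment> \<open>The score is at most 0.6 + 8 = 8.6, below 15.2.\<close>
      using tool_score_le[of a] by (simp add: tier_def tier_of_score_eq risk_score_eq)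
  qed
  show "\<exists>a. valid_agent a \<and> (1 - alpha) * tool_score a = (1 - alpha) * T_max"
    using ex_tool_score_eq_T_max by metis
  show "\<forall>a st. valid_agent a \<longrightarrow>
      (\<exists>S :: nat agent_system. wf_system S \<and>
         (\<exists>v\<in>nodes S. profile S v = a \<and> status S v = st))"
    using ex_system_with_status by blast
qed (simp_all add: R_max_eq alpha_def T_max_def tool_score_le tool_score_def raw_tool_score_eq
  risk_score_eq naive_score_def tier_def tier_of_score_eq status_eq_Blocked_iff
  status_profile_update conflated_status_Tier1 status_no_failing)

end
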